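(* Every nonempty partition diagram $\pi$ admits a decomposition $\pi = \theta^{(1)} \bullet \theta^{(2)} \bullet \cdots \bullet \theta^{(m)}$ into nonempty $\bullet$-irreducible partition diagrams $\theta^{(1)},\dots,\theta^{(m)}$, and this decomposition is unique; in particular $m = m(\pi)$ is determined by $\pi$.
   Context: A partition diagram of order $k$ is a set partition of $\{1,\ldots,k,1',\ldots,k'\}$; nonempty means $k\geq1$. For $\pi$ of order $k$, $\rho$ of order $l$, $\pi\otimes\rho$ (order $k+l$) has as blocks the blocks of $\pi$ and the blocks of $\rho$ with $i\mapsto i+k$, $i'\mapsto(i+k)'$. For nonempty $\pi,\rho$ of orders $k,l$, $\pi\bullet\rho$ is the order-$(k+l)$ diagram obtained from $\pi\otimes\rho$ by merging the block containing $k'$ with the block containing $(k+1)'$; $\bullet$ is associative. A nonempty diagram is $\bullet$-irreducible if it cannot be written as $\theta_1\bullet\theta_2$ with $\theta_1,\theta_2$ nonempty diagrams. *)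

theory Defs
  imports Main "HOL-Library.Disjoint_Sets"
begin

text \<open>\<open>Unprimed i\<close> stands for the vertex \<open>i\<close> and \<open>Primed i\<close> for the vertex \<open>i'\<close>.\<close>

datatype vertex = Unprimed nat | Primed nat

definition vertices :: "nat \<Rightarrow> vertex set" where
  "vertices k = Unprimed ` {1..k} \<union> Primed ` {1..k}"

type_synonym diagram = "vertex set set"

definition diagram_of_order :: "nat \<Rightarrow> diagram \<Rightarrow> bool" where
  "diagram_of_order k P \<longleftrightarrow> partition_on (vertices k) P"

definition nonempty_diagram :: "diagram \<Rightarrow> bool" where
  "nonempty_diagram P \<longleftrightarrow> (\<exists>k\<ge>1. diagram_of_order k P)"

text \<open>A set of blocks determines its ground set, hence the order of the diagram; see
  \<open>diagram_order_eq\<close> below.\<close>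

definition diagram_order :: "diagram \<Rightarrow> nat" where
  "diagram_order P = (THE k. diagram_of_order k P)"

fun shift :: "nat \<Rightarrow> vertex \<Rightarrow> vertex" where
  "shift k (Unprimed i) = Unprimed (i + k)"
| "shift k (Primed i) = Primed (i + k)"

definition tensor :: "diagram \<Rightarrow> diagram \<Rightarrow> diagram"  (infixr \<open>\<otimes>\<^sub>D\<close> 70) where
  "P \<otimes>\<^sub>D R = P \<union> (\<lambda>B. shift (diagram_order P) ` B) ` R"

definition block_of :: "diagram \<Rightarrow> vertex \<Rightarrow> vertex set" where
  "block_of P v = (THE B. B \<in> P \<and> v \<in> B)"

definition merge_blocks :: "vertex \<Rightarrow> vertex \<Rightarrow> diagram \<Rightarrow> diagram" where
  "merge_blocks v w P =
     insert (block_of P v \<union> block_of P w) (P - {block_of P v, block_of P w})"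

text \<open>Only meaningful when both arguments are nonempty diagrams.\<close>

definition bullet :: "diagram \<Rightarrow> diagram \<Rightarrow> diagram"  (infixr \<open>\<bullet>\<^sub>D\<close> 70) where
  "P \<bullet>\<^sub>D R =
     merge_blocks (Primed (diagram_order P)) (Primed (diagram_order P + 1)) (P \<otimes>\<^sub>D R)"

definition bullet_irreducible :: "diagram \<Rightarrow> bool" where
  "bullet_irreducible P \<longleftrightarrow>
     nonempty_diagram P \<and>
     \<not> (\<exists>T1 T2. nonempty_diagram T1 \<and> nonempty_diagram T2 \<and> P = T1 \<bullet>\<^sub>D T2)"

text \<open>The iterated product, bracketed to the right (the operation is associative on nonempty
  diagrams, so the bracketing is immaterial). The value on the empty list is never used.\<close>

fun bullet_list :: "diagram list \<Rightarrow> diagram" where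
  "bullet_list [] = {}"
| "bullet_list [T] = T"
| "bullet_list (T # T' # Ts) = T \<bullet>\<^sub>D bullet_list (T' # Ts)"

definition bullet_decomposition :: "diagram \<Rightarrow> diagram list \<Rightarrow> bool" where
  "bullet_decomposition P Ts \<longleftrightarrow>
     Ts \<noteq> [] \<and> (\<forall>T \<in> set Ts. bullet_irreducible T) \<and> P = bullet_list Ts"

lemma vertices_inject: "vertices k = vertices l \<longleftrightarrow> k = l"
proof
  assume *: "vertices k = vertices l"
  have "{i. Unprimed i \<in> vertices n} = {1..n}" for n
    by (auto simp: vertices_def)
  with * have "{1..k} = {1..l}" by metis
  then show "k = l" by (metis card_atLeastAtMost diff_Suc_1)
qed simp

lemma diagram_order_eq: "diagram_of_order k P \<Longrightarrow> diagram_order P = k"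
  unfolding diagram_order_def diagram_of_order_def
  by (rule the_equality) (auto simp: partition_on_def vertices_inject)

lemma block_of_eq:
  "\<lbrakk>diagram_of_order k P; B \<in> P; v \<in> B\<rbrakk> \<Longrightarrow> block_of P v = B"
  unfolding block_of_def diagram_of_order_def partition_on_def disjoint_def
  by (rule the_equality) auto

end

theory Submission
  imports Defs
begin

text \<open>View a diagram as the equivalence relation \<open>linked\<close> on its vertices. For diagrams of
  orders \<open>k\<close> and \<open>l\<close>, the relation of \<open>P \<bullet>\<^sub>D Q\<close> restricts to those of \<open>P\<close> and
  (shifted) \<open>Q\<close>, and a vertex \<open>x\<close> of \<open>P\<close> is linked to a vertex \<open>v\<close> of \<open>Q\<close> iff \<open>x\<close> is linked
  to \<open>k'\<close> and \<open>v\<close> to \<open>1'\<close>. Hence the product is associative, and a product together with the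
  order of its first factor determines both factors. If \<open>T \<bullet>\<^sub>D Q = S \<bullet>\<^sub>D R\<close> with \<open>T\<close> of
  smaller order than \<open>S\<close>, restricting to the vertices of \<open>S\<close> gives \<open>S = T \<bullet>\<^sub>D X\<close>, where
  \<open>X\<close> is a restriction of \<open>Q\<close>. So the first irreducible factor is unique, and uniqueness follows
  by induction.\<close>

section \<open>Partitions viewed as equivalence relations\<close>

definition linked :: "'a set set \<Rightarrow> 'a \<Rightarrow> 'a \<Rightarrow> bool" where
  "linked P x y \<longleftrightarrow> (\<exists>B\<in>P. x \<in> B \<and> y \<in> B)"

lemma linked_sym: "linked P x y \<longleftrightarrow> linked P y x"
  by (auto simp: linked_def)

lemma linked_in:
  assumes "partition_on A P" "linked P x y"
  shows "x \<in> A" "y \<in> A"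
  using assms by (auto simp: linked_def partition_on_def)

lemma linked_block:
  assumes "partition_on A P" "B \<in> P" "x \<in> B"
  shows "linked P y x \<longleftrightarrow> y \<in> B"
  using assms by (auto simp: linked_def partition_on_def disjoint_def)

lemma linked_trans:
  assumes "partition_on A P" "linked P x y" "linked P y z"
  shows "linked P x z"
  using assms by (auto simp: linked_def partition_on_def disjoint_def)

text \<open>A partition is the quotient of its ground set by its relation \<open>linked\<close>, so
  equal relations give equal partitions. The equalities of products, first factors and second
  factors below are reduced to comparing links in this way.\<close>

lemma partition_on_eqI:
  assumes "partition_on A P" "partition_on A Q"
    and "\<And>x y. x \<in> A \<Longrightarrow> y \<in> A \<Longrightarrow> linked P x y \<longleftrightarrow> linked Q x y"
  shows "P = Q"
proof -
  have "linked P x y \<longleftrightarrow> linked Q x y" for x y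
    using assms(3)[of x y] linked_in[OF assms(1), of x y] linked_in[OF assms(2), of x y] by blast
  then have "{(x, y). \<exists>p\<in>P. x \<in> p \<and> y \<in> p} = {(x, y). \<exists>p\<in>Q. x \<in> p \<and> y \<in> p}"
    unfolding linked_def by simp
  then have "A // {(x, y). \<exists>p\<in>P. x \<in> p \<and> y \<in> p} = A // {(x, y). \<exists>p\<in>Q. x \<in> p \<and> y \<in> p}"
    by (rule arg_cong)
  then show ?thesis
    unfolding partition_on_eq_quotient[OF assms(1)] partition_on_eq_quotient[OF assms(2)] .
qed

lemma partition_on_merge:
  assumes "partition_on A P" "B \<in> P" "C \<in> P"
  shows "partition_on A (insert (B \<union> C) (P - {B, C}))"
proof (rule partition_onI)
  show "\<Union> (insert (B \<union> C) (P - {B, C})) = A"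
    using assms by (auto simp: partition_on_def)
  show "disjnt p q"
    if "p \<in> insert (B \<union> C) (P - {B, C})" "q \<in> insert (B \<union> C) (P - {B, C})" "p \<noteq> q" for p q
    using that assms unfolding partition_on_def disjoint_def disjnt_def by blast
  show "{} \<notin> insert (B \<union> C) (P - {B, C})"
    using assms by (auto simp: partition_on_def)
qed

text \<open>Discarding \<open>B\<close> and \<open>C\<close> loses no link, since every pair inside
  either of them lies in \<open>B \<union> C\<close>. No disjointness is involved, so the rule works
  for any family of sets.\<close>

lemma linked_merge:
  "linked (insert (B \<union> C) (P - {B, C})) x y \<longleftrightarrow>
     linked P x y \<or> (x \<in> B \<union> C \<and> y \<in> B \<union> C)"
  by (auto simp: linked_def)

text \<open>The trace of a partition on \<open>A\<close>; blocks that miss \<open>A\<close> would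
  leave the empty set, which is removed.\<close>

definition restrict_blocks :: "'a set \<Rightarrow> 'a set set \<Rightarrow> 'a set set" where
  "restrict_blocks A P = (\<inter>) A ` P - {{}}"

lemma partition_on_restrict_blocks:
  "partition_on A P \<Longrightarrow> A' \<subseteq> A \<Longrightarrow> partition_on A' (restrict_blocks A' P)"
  using partition_on_restrict[of A P A'] by (simp add: restrict_blocks_def Int_absorb2)

lemma linked_restrict_blocks:
  "linked (restrict_blocks A P) x y \<longleftrightarrow> linked P x y \<and> x \<in> A \<and> y \<in> A"
  by (auto simp: linked_def restrict_blocks_def)

section \<open>Shifts and vertex sets\<close>

lemma inj_shift: "inj (shift k)"
proof (rule injI)
  fix x y assume "shift k x = shift k y"
  then show "x = y" by (cases x; cases y) auto
qed

lemma shift_eq_iff [simp]: "shift k x = shift k y \<longleftrightarrow> x = y"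
  by (rule inj_eq[OF inj_shift])

lemma shift_shift: "shift k (shift l x) = shift (l + k) x"
  by (cases x) auto

lemma vertices_iff [simp]:
  "Unprimed i \<in> vertices k \<longleftrightarrow> 1 \<le> i \<and> i \<le> k"
  "Primed i \<in> vertices k \<longleftrightarrow> 1 \<le> i \<and> i \<le> k"
  by (auto simp: vertices_def)

lemma vertices_mono: "k \<le> l \<Longrightarrow> vertices k \<subseteq> vertices l"
  by (auto simp: vertices_def)

lemma shift_notin_vertices: "v \<in> vertices l \<Longrightarrow> shift k v \<notin> vertices k"
  by (cases v) auto

text \<open>The premise serves to exclude index 0: \<open>Unprimed 0\<close> is in no vertex set,
  yet for positive \<open>k\<close> its shift is in \<open>vertices (k + l)\<close>. The bound
  \<open>m\<close> is unrelated to \<open>l\<close>.\<close>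

lemma shift_in_vertices_iff [simp]:
  "v \<in> vertices m \<Longrightarrow> shift k v \<in> vertices (k + l) \<longleftrightarrow> v \<in> vertices l"
  by (cases v) auto

lemma vertices_add: "vertices (k + l) = vertices k \<union> shift k ` vertices l"
proof
  show "vertices (k + l) \<subseteq> vertices k \<union> shift k ` vertices l"
  proof
    fix x assume x: "x \<in> vertices (k + l)"
    show "x \<in> vertices k \<union> shift k ` vertices l"
    proof (cases x)
      case (Unprimed i)
      have "x = shift k (Unprimed (i - k)) \<and> Unprimed (i - k) \<in> vertices l" if "\<not> i \<le> k"
        using that x Unprimed by auto
      then show ?thesis using x Unprimed by (cases "i \<le> k") (simp, blast)
    next
      case (Primed i)
      have "x = shift k (Primed (i - k)) \<and> Primed (i - k) \<in> vertices l" if "\<not> i \<le> k"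
        using that x Primed by auto
      then show ?thesis using x Primed by (cases "i \<le> k") (simp, blast)
    qed
  qed
  show "vertices k \<union> shift k ` vertices l \<subseteq> vertices (k + l)"
    using vertices_mono[of k "k + l"] by auto
qed

lemma vertices_add_cases:
  assumes "x \<in> vertices (k + l)"
  obtains "x \<in> vertices k" | v where "x = shift k v" "v \<in> vertices l"
  using assms by (auto simp: vertices_add)

section \<open>Blocks and links of a product\<close>

lemma diagram_of_order_tensor:
  assumes "diagram_of_order k P" "diagram_of_order l Q"
  shows "diagram_of_order (k + l) (P \<otimes>\<^sub>D Q)"
  unfolding diagram_of_order_def tensor_def diagram_order_eq[OF assms(1)] vertices_add
proof -
  have P: "disjoint P" "{} \<notin> P" "\<Union> P = vertices k"
    and Q: "disjoint Q" "{} \<notin> Q" "\<Union> Q = vertices l"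
    using assms by (auto simp: diagram_of_order_def partition_on_def)
  have "disjoint ((`) (shift k) ` Q)"
    using Q(1) by (intro disjoint_image) (auto intro: inj_on_subset[OF inj_shift])
  moreover have "\<Union> P \<inter> \<Union> ((`) (shift k) ` Q) = {}"
    unfolding P(3) using Q(3) shift_notin_vertices by blast
  ultimately have "disjoint (P \<union> (`) (shift k) ` Q)"
    using P(1) by (intro disjoint_union)
  then show "partition_on (vertices k \<union> shift k ` vertices l) (P \<union> (`) (shift k) ` Q)"
    using P(2) Q(2) unfolding partition_on_def P(3)[symmetric] Q(3)[symmetric]
    by (auto simp: image_Union)
qed

context
  fixes k l :: nat and P Q :: diagram
  assumes PQ: "diagram_of_order k P" "diagram_of_order l Q" and pos: "1 \<le> k" "1 \<le> l"
begin

text \<open>Replaces the descriptions \<open>block_of\<close> by actual blocks of \<open>P\<close>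
  and \<open>Q\<close>. The order and the links of the product are both read off from this
  form.\<close>

lemma bullet_eq_merge:
  obtains B C where "B \<in> P" "C \<in> Q" "Primed k \<in> B" "Primed 1 \<in> C"
    "P \<bullet>\<^sub>D Q = insert (B \<union> shift k ` C) ((P \<otimes>\<^sub>D Q) - {B, shift k ` C})"
    "B \<in> P \<otimes>\<^sub>D Q" "shift k ` C \<in> P \<otimes>\<^sub>D Q"
proof -
  have "Primed k \<in> \<Union> P" "Primed 1 \<in> \<Union> Q"
    using PQ pos by (auto simp: diagram_of_order_def partition_on_def)
  then obtain B C where BC: "B \<in> P" "C \<in> Q" "Primed k \<in> B" "Primed 1 \<in> C" by blast
  have mem: "B \<in> P \<otimes>\<^sub>D Q" "shift k ` C \<in> P \<otimes>\<^sub>D Q"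
    using BC by (auto simp: tensor_def diagram_order_eq[OF PQ(1)])
  \<comment> \<open>The second merged vertex is \<open>Primed 1\<close> of \<open>Q\<close> after
    the shift, so its block is the image of \<open>C\<close>.\<close>
  have "Primed (k + 1) \<in> shift k ` C"
    using BC(4) by (force intro: image_eqI[of _ _ "Primed 1"])
  then have "block_of (P \<otimes>\<^sub>D Q) (Primed k) = B"
      "block_of (P \<otimes>\<^sub>D Q) (Primed (k + 1)) = shift k ` C"
    using block_of_eq[OF diagram_of_order_tensor[OF PQ]] mem BC by blast+
  then show thesis
    using BC mem that by (simp add: bullet_def merge_blocks_def diagram_order_eq[OF PQ(1)])
qed

lemma diagram_of_order_bullet: "diagram_of_order (k + l) (P \<bullet>\<^sub>D Q)"
proof -
  obtain B C where "B \<in> P \<otimes>\<^sub>D Q" "shift k ` C \<in> P \<otimes>\<^sub>D Q"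
    "P \<bullet>\<^sub>D Q = insert (B \<union> shift k ` C) ((P \<otimes>\<^sub>D Q) - {B, shift k ` C})"
    using bullet_eq_merge by metis
  then show ?thesis
    using partition_on_merge diagram_of_order_tensor[OF PQ] by (metis diagram_of_order_def)
qed

text \<open>The first two disjuncts are the links of the tensor product. The last one says that
  \<open>x\<close> and \<open>y\<close> both lie in the merged block, each in its \<open>P\<close>
  part or in its shifted \<open>Q\<close> part.\<close>

lemma linked_bullet_iff:
  "linked (P \<bullet>\<^sub>D Q) x y \<longleftrightarrow>
     linked P x y \<or> (\<exists>u v. x = shift k u \<and> y = shift k v \<and> linked Q u v) \<or>
     (linked P x (Primed k) \<or> (\<exists>u. x = shift k u \<and> linked Q (Primed 1) u)) \<and>
     (linked P y (Primed k) \<or> (\<exists>v. y = shift k v \<and> linked Q (Primed 1) v))"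
proof -
  obtain B C where BC: "B \<in> P" "C \<in> Q" "Primed k \<in> B" "Primed 1 \<in> C"
    and eq: "P \<bullet>\<^sub>D Q = insert (B \<union> shift k ` C) ((P \<otimes>\<^sub>D Q) - {B, shift k ` C})"
    using bullet_eq_merge by metis
  have B: "linked P z (Primed k) \<longleftrightarrow> z \<in> B" for z
    using linked_block PQ(1) BC(1,3) by (metis diagram_of_order_def)
  have C: "linked Q (Primed 1) z \<longleftrightarrow> z \<in> C" for z
    using linked_block linked_sym PQ(2) BC(2,4) by (metis diagram_of_order_def)
  have "linked (P \<otimes>\<^sub>D Q) x y \<longleftrightarrow>
      linked P x y \<or> (\<exists>u v. x = shift k u \<and> y = shift k v \<and> linked Q u v)"
    by (auto simp: linked_def tensor_def diagram_order_eq[OF PQ(1)])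
  then show ?thesis
    unfolding eq linked_merge B C by blast
qed

lemma linked_vertices:
  "linked P x y \<Longrightarrow> x \<in> vertices k" "linked P x y \<Longrightarrow> y \<in> vertices k"
  "linked Q x y \<Longrightarrow> x \<in> vertices l" "linked Q x y \<Longrightarrow> y \<in> vertices l"
  using PQ linked_in[of "vertices k" P x y] linked_in[of "vertices l" Q x y]
  by (simp_all add: diagram_of_order_def)

lemma not_linked_shift:
  assumes "v \<in> vertices l"
  shows "\<not> linked P x (shift k v)" "\<not> linked P (shift k v) x"
  using linked_vertices(1)[of "shift k v" x] linked_vertices(2)[of x "shift k v"]
    shift_notin_vertices[OF assms] by auto

lemma shift_linked_notin:
  assumes "linked Q u v"
  shows "shift k u \<notin> vertices k" "shift k v \<notin> vertices k"
  using linked_vertices(3,4)[OF assms] shift_notin_vertices by simp_all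

text \<open>The merge creates no new link inside \<open>P\<close>: two vertices of \<open>P\<close>
  in the merged block are both linked to \<open>Primed k\<close> already.\<close>

lemma linked_bullet_left:
  assumes "x \<in> vertices k" "y \<in> vertices k"
  shows "linked (P \<bullet>\<^sub>D Q) x y \<longleftrightarrow> linked P x y"
proof -
  have "linked P x y" if "linked P x (Primed k)" "linked P y (Primed k)"
    using that linked_trans[OF PQ(1)[unfolded diagram_of_order_def]] linked_sym by metis
  then show ?thesis
    using assms by (auto simp: linked_bullet_iff dest: shift_linked_notin)
qed

lemma linked_bullet_right:
  assumes "u \<in> vertices l" "v \<in> vertices l"
  shows "linked (P \<bullet>\<^sub>D Q) (shift k u) (shift k v) \<longleftrightarrow> linked Q u v"
proof -
  have "linked Q u v" if "linked Q (Primed 1) u" "linked Q (Primed 1) v"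
    using that linked_trans[OF PQ(2)[unfolded diagram_of_order_def]] linked_sym by metis
  then show ?thesis
    using assms by (auto simp: linked_bullet_iff not_linked_shift)
qed

text \<open>No block of the tensor product meets both sides, so a link across can only come from the
  merged block.\<close>

lemma linked_bullet_cross:
  assumes "x \<in> vertices k" "v \<in> vertices l"
  shows "linked (P \<bullet>\<^sub>D Q) x (shift k v) \<longleftrightarrow> linked P x (Primed k) \<and> linked Q (Primed 1) v"
    and "linked (P \<bullet>\<^sub>D Q) (shift k v) x \<longleftrightarrow> linked P x (Primed k) \<and> linked Q (Primed 1) v"
  using assms by (auto simp: linked_bullet_iff not_linked_shift dest: shift_linked_notin)

lemmas linked_bullet = linked_bullet_left linked_bullet_right linked_bullet_cross

end

section \<open>Associativity, cancellation and refinement\<close>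

text \<open>Each of \<open>x\<close> and \<open>y\<close> lies in the part of \<open>A\<close>,
  \<open>B\<close> or \<open>C\<close>. In all nine cases the links of both bracketings reduce to
  the same condition on the three factors.\<close>

lemma bullet_assoc:
  assumes A: "diagram_of_order a A" "1 \<le> a" and B: "diagram_of_order b B" "1 \<le> b"
    and C: "diagram_of_order c C" "1 \<le> c"
  shows "(A \<bullet>\<^sub>D B) \<bullet>\<^sub>D C = A \<bullet>\<^sub>D (B \<bullet>\<^sub>D C)"
proof -
  have AB: "diagram_of_order (a + b) (A \<bullet>\<^sub>D B)" "1 \<le> a + b"
    and BC: "diagram_of_order (b + c) (B \<bullet>\<^sub>D C)" "1 \<le> b + c"
    using diagram_of_order_bullet A B C by auto
  note lAB = linked_bullet[OF A(1) B(1) A(2) B(2)]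
  note lBC = linked_bullet[OF B(1) C(1) B(2) C(2)]
  note lAB_C = linked_bullet[OF AB(1) C(1) AB(2) C(2)]
  note lA_BC = linked_bullet[OF A(1) BC(1) A(2) BC(2)]
  have shift_ab: "shift (a + b) w = shift a (shift b w)" for w
    by (simp add: shift_shift add.commute)
  have in_AB: "x \<in> vertices a \<Longrightarrow> x \<in> vertices (a + b)" for x
    by (simp add: vertices_add)
  have in_BC: "v \<in> vertices b \<Longrightarrow> v \<in> vertices (b + c)" for v
    by (simp add: vertices_add)
  have ends: "Primed a \<in> vertices a" "Primed b \<in> vertices b" "Primed 1 \<in> vertices b"
    "Primed (a + b) = shift a (Primed b)"
    using A(2) B(2) by auto
  \<comment> \<open>The outer product on the left glues at the last primed vertex of the inner one,
    which belongs to \<open>B\<close>. A vertex of \<open>A\<close> reaches it only through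
    \<open>Primed a\<close>, then \<open>Primed 1\<close> and \<open>Primed b\<close> of
    \<open>B\<close>. \<open>start_BC\<close> is the mirror image.\<close>
  have end_AB:
    "x \<in> vertices a \<Longrightarrow> linked (A \<bullet>\<^sub>D B) x (Primed (a + b)) \<longleftrightarrow>
       linked A x (Primed a) \<and> linked B (Primed 1) (Primed b)"
    "v \<in> vertices b \<Longrightarrow>
       linked (A \<bullet>\<^sub>D B) (shift a v) (Primed (a + b)) \<longleftrightarrow> linked B v (Primed b)" for x v
    unfolding ends(4) using lAB ends by blast+
  have start_BC:
    "v \<in> vertices b \<Longrightarrow> linked (B \<bullet>\<^sub>D C) (Primed 1) v \<longleftrightarrow> linked B (Primed 1) v"
    "w \<in> vertices c \<Longrightarrow> linked (B \<bullet>\<^sub>D C) (Primed 1) (shift b w) \<longleftrightarrow>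
       linked B (Primed 1) (Primed b) \<and> linked C (Primed 1) w" for v w
    using lBC ends by blast+
  show ?thesis
  proof (rule partition_on_eqI)
    show "partition_on (vertices (a + b + c)) ((A \<bullet>\<^sub>D B) \<bullet>\<^sub>D C)"
      using diagram_of_order_bullet AB C by (simp add: diagram_of_order_def)
    show "partition_on (vertices (a + b + c)) (A \<bullet>\<^sub>D (B \<bullet>\<^sub>D C))"
      using diagram_of_order_bullet A BC by (simp add: diagram_of_order_def add.assoc)
  next
    fix x y assume "x \<in> vertices (a + b + c)" "y \<in> vertices (a + b + c)"
    moreover have "x \<in> vertices a \<or> (\<exists>v\<in>vertices b. x = shift a v) \<or>
        (\<exists>w\<in>vertices c. x = shift (a + b) w)" if "x \<in> vertices (a + b + c)" for x
      using that by (auto simp: vertices_add)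
    ultimately have
      "x \<in> vertices a \<or> (\<exists>v\<in>vertices b. x = shift a v) \<or>
        (\<exists>w\<in>vertices c. x = shift (a + b) w)"
      "y \<in> vertices a \<or> (\<exists>v\<in>vertices b. y = shift a v) \<or>
        (\<exists>w\<in>vertices c. y = shift (a + b) w)"
      by blast+
    then show "linked ((A \<bullet>\<^sub>D B) \<bullet>\<^sub>D C) x y \<longleftrightarrow> linked (A \<bullet>\<^sub>D (B \<bullet>\<^sub>D C)) x y"
      \<comment> \<open>The first pass evaluates the left bracketing. Only then is the shift by
        \<open>a + b\<close> split in two, as the rules for the right bracketing require. Deleting
        \<open>One_nat_def\<close> keeps \<open>Primed 1\<close> in the form used by these
        rules.\<close>
      by (elim disjE bexE; simp add: lAB_C in_AB lAB end_AB del: One_nat_def;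
          simp add: shift_ab lA_BC in_BC lBC start_BC del: One_nat_def)
  qed
qed

text \<open>With first factors of equal order, the total order forces \<open>q = r\<close>. Each
  factor is then recovered from the links of the product on its own vertices.\<close>

lemma bullet_cancel:
  assumes T: "diagram_of_order t T" "1 \<le> t" and S: "diagram_of_order t S"
    and Q: "diagram_of_order q Q" "1 \<le> q" and R: "diagram_of_order r R" "1 \<le> r"
    and eq: "T \<bullet>\<^sub>D Q = S \<bullet>\<^sub>D R"
  shows "T = S" "Q = R"
proof -
  have "diagram_of_order (t + q) (T \<bullet>\<^sub>D Q)" "diagram_of_order (t + r) (T \<bullet>\<^sub>D Q)"
    using diagram_of_order_bullet[OF T(1) Q(1) T(2) Q(2)]
      diagram_of_order_bullet[OF S R(1) T(2) R(2)] eq by simp_all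
  then have "t + q = t + r"
    by (auto dest!: diagram_order_eq)
  then have [simp]: "r = q" by simp
  show "T = S"
    using linked_bullet_left[OF T(1) Q(1) T(2) Q(2)]
      linked_bullet_left[OF S(1) R(1) T(2) R(2)] T S eq
    by (intro partition_on_eqI[of "vertices t"]) (auto simp: diagram_of_order_def)
  show "Q = R"
    using linked_bullet_right[OF T(1) Q(1) T(2) Q(2)]
      linked_bullet_right[OF S(1) R(1) T(2) R(2)] Q R eq
    by (intro partition_on_eqI[of "vertices q"]) (auto simp: diagram_of_order_def)
qed

text \<open>\<open>X\<close> is the trace of \<open>Q\<close> on its first \<open>s - t\<close>
  positions, which are the positions of \<open>S\<close> beyond those of \<open>T\<close>.\<close>

lemma bullet_refine:
  assumes T: "diagram_of_order t T" "1 \<le> t" and S: "diagram_of_order s S" and "t < s"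
    and Q: "diagram_of_order q Q" "1 \<le> q" and R: "diagram_of_order r R" "1 \<le> r"
    and eq: "T \<bullet>\<^sub>D Q = S \<bullet>\<^sub>D R"
  obtains X where "nonempty_diagram X" "S = T \<bullet>\<^sub>D X"
proof -
  define d where "d = s - t"
  define X where "X = restrict_blocks (vertices d) Q"
  have s: "s = t + d" "1 \<le> d" "1 \<le> s" using \<open>t < s\<close> by (auto simp: d_def)
  have "diagram_of_order (t + q) (T \<bullet>\<^sub>D Q)" "diagram_of_order (s + r) (T \<bullet>\<^sub>D Q)"
    using diagram_of_order_bullet[OF T(1) Q(1) T(2) Q(2)]
      diagram_of_order_bullet[OF S R(1) s(3) R(2)] eq by simp_all
  then have "t + q = s + r"
    by (auto dest!: diagram_order_eq)
  \<comment> \<open>Cancelling \<open>t\<close> gives \<open>q = d + r\<close>, hence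
    \<open>d \<le> q\<close>.\<close>
  then have dq: "vertices d \<subseteq> vertices q" using s by (intro vertices_mono) simp
  then have X: "diagram_of_order d X"
    unfolding diagram_of_order_def X_def
    using partition_on_restrict_blocks Q(1) diagram_of_order_def by blast
  have lX: "linked X u v \<longleftrightarrow> linked Q u v" if "u \<in> vertices d" "v \<in> vertices d" for u v
    using that by (simp add: X_def linked_restrict_blocks)
  \<comment> \<open>Since \<open>t < s\<close>, the gluing vertex of \<open>Q\<close> survives the
    restriction, so links between \<open>T\<close> and \<open>X\<close> are the same as those
    between \<open>T\<close> and \<open>Q\<close>.\<close>
  have "Primed 1 \<in> vertices d" using s(2) by simp
  note lTQ = linked_bullet[OF T(1) Q(1) T(2) Q(2)]
  note lTX = linked_bullet[OF T(1) X T(2) s(2)]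
  note lSR = linked_bullet_left[OF S R(1) s(3) R(2)]
  have "S = T \<bullet>\<^sub>D X"
  proof (rule partition_on_eqI)
    show "partition_on (vertices s) S" using S by (simp add: diagram_of_order_def)
    show "partition_on (vertices s) (T \<bullet>\<^sub>D X)"
      using diagram_of_order_bullet[OF T(1) X T(2) s(2)] s by (simp add: diagram_of_order_def)
  next
    fix x y assume xy: "x \<in> vertices s" "y \<in> vertices s"
    have "linked S x y \<longleftrightarrow> linked (T \<bullet>\<^sub>D Q) x y" using lSR xy eq by simp
    also have "\<dots> \<longleftrightarrow> linked (T \<bullet>\<^sub>D X) x y"
      using xy dq \<open>Primed 1 \<in> vertices d\<close> unfolding s(1)
      by (elim vertices_add_cases; simp add: lTQ lTX lX subset_iff del: One_nat_def vertices_iff)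
    finally show "linked S x y \<longleftrightarrow> linked (T \<bullet>\<^sub>D X) x y" .
  qed
  then show thesis using that X s(2) by (auto simp: nonempty_diagram_def)
qed

section \<open>Existence of a decomposition\<close>

lemma nonempty_diagram_bullet:
  "nonempty_diagram P \<Longrightarrow> nonempty_diagram Q \<Longrightarrow> nonempty_diagram (P \<bullet>\<^sub>D Q)"
proof -
  assume "nonempty_diagram P" "nonempty_diagram Q"
  then obtain k l where kl: "1 \<le> k" "1 \<le> l" "diagram_of_order k P" "diagram_of_order l Q"
    by (auto simp: nonempty_diagram_def)
  then have "diagram_of_order (k + l) (P \<bullet>\<^sub>D Q)" "1 \<le> k + l"
    using diagram_of_order_bullet by auto
  then show ?thesis unfolding nonempty_diagram_def by blast
qed

lemma nonempty_bullet_list: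
  "Ts \<noteq> [] \<Longrightarrow> \<forall>T\<in>set Ts. nonempty_diagram T \<Longrightarrow> nonempty_diagram (bullet_list Ts)"
  by (induction Ts rule: bullet_list.induct) (auto intro: nonempty_diagram_bullet)

text \<open>Associativity moves the brackets of \<open>bullet_list\<close> to the right. This lets
  decompositions of two factors be concatenated.\<close>

lemma bullet_list_append:
  assumes "Ts \<noteq> []" "Ss \<noteq> []" "\<forall>T\<in>set Ts \<union> set Ss. nonempty_diagram T"
  shows "bullet_list (Ts @ Ss) = bullet_list Ts \<bullet>\<^sub>D bullet_list Ss"
  using assms
proof (induction Ts rule: bullet_list.induct)
  case (2 T)
  then show ?case by (cases Ss) auto
next
  case (3 T T' Ts)
  have "nonempty_diagram T" "nonempty_diagram (bullet_list (T' # Ts))"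
    "nonempty_diagram (bullet_list Ss)"
    using 3 by (auto intro!: nonempty_bullet_list)
  then have "(T \<bullet>\<^sub>D bullet_list (T' # Ts)) \<bullet>\<^sub>D bullet_list Ss =
      T \<bullet>\<^sub>D (bullet_list (T' # Ts) \<bullet>\<^sub>D bullet_list Ss)"
    using bullet_assoc unfolding nonempty_diagram_def by blast
  then show ?case using 3 by simp
qed simp

lemma nonempty_diagram_order:
  assumes "nonempty_diagram P"
  shows "diagram_of_order (diagram_order P) P" "1 \<le> diagram_order P"
proof -
  obtain k where k: "1 \<le> k" "diagram_of_order k P"
    using assms by (auto simp: nonempty_diagram_def)
  then show "diagram_of_order (diagram_order P) P" "1 \<le> diagram_order P"
    by (simp_all add: diagram_order_eq[OF k(2)])
qed

lemma diagram_order_bullet: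
  assumes "nonempty_diagram P" "nonempty_diagram Q"
  shows "diagram_order (P \<bullet>\<^sub>D Q) = diagram_order P + diagram_order Q"
  using assms nonempty_diagram_order
  by (intro diagram_order_eq diagram_of_order_bullet)

text \<open>Strong induction on the order: orders add up and are at least 1, so both factors of a
  reducible diagram have smaller order.\<close>

lemma bullet_decomposition_exists:
  "nonempty_diagram P \<Longrightarrow> \<exists>Ts. bullet_decomposition P Ts"
proof (induction "diagram_order P" arbitrary: P rule: less_induct)
  case less
  show ?case
  proof (cases "bullet_irreducible P")
    case True
    then have "bullet_decomposition P [P]" by (simp add: bullet_decomposition_def)
    then show ?thesis ..
  next
    case False
    then obtain T S where TS: "nonempty_diagram T" "nonempty_diagram S" "P = T \<bullet>\<^sub>D S"
      using less.prems by (auto simp: bullet_irreducible_def)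
    have "diagram_order P = diagram_order T + diagram_order S"
      unfolding TS(3) by (rule diagram_order_bullet[OF TS(1,2)])
    then have "diagram_order T < diagram_order P" "diagram_order S < diagram_order P"
      using nonempty_diagram_order(2)[OF TS(1)] nonempty_diagram_order(2)[OF TS(2)] by linarith+
    then obtain Ts Ss where "bullet_decomposition T Ts" "bullet_decomposition S Ss"
      using less.hyps TS(1,2) by meson
    moreover from this have "\<forall>T\<in>set Ts \<union> set Ss. nonempty_diagram T"
      by (auto simp: bullet_decomposition_def bullet_irreducible_def)
    ultimately have "bullet_decomposition P (Ts @ Ss)"
      using bullet_list_append[of Ts Ss] TS(3) by (auto simp: bullet_decomposition_def)
    then show ?thesis ..
  qed
qed

section \<open>Uniqueness of the decomposition\<close>

text \<open>If \<open>T\<close> were shorter, \<open>bullet_refine\<close> would split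
  \<open>S\<close> as a product starting with \<open>T\<close>.\<close>

lemma irreducible_factor_le:
  assumes "nonempty_diagram T" "bullet_irreducible S" "nonempty_diagram Q" "nonempty_diagram R"
    and "T \<bullet>\<^sub>D Q = S \<bullet>\<^sub>D R"
  shows "diagram_order S \<le> diagram_order T"
proof (rule ccontr)
  assume "\<not> ?thesis"
  then have less: "diagram_order T < diagram_order S" by simp
  have "nonempty_diagram S" using assms(2) by (simp add: bullet_irreducible_def)
  from bullet_refine[OF _ _ _ less _ _ _ _ assms(5)] obtain X
    where "nonempty_diagram X" "S = T \<bullet>\<^sub>D X"
    using assms \<open>nonempty_diagram S\<close> nonempty_diagram_order by metis
  then show False using assms by (auto simp: bullet_irreducible_def)
qed

lemma bullet_decomposition_Cons_Cons:
  assumes "bullet_decomposition P (T # T' # Ts)"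
  shows "P = T \<bullet>\<^sub>D bullet_list (T' # Ts)"
    "bullet_decomposition (bullet_list (T' # Ts)) (T' # Ts)"
    "bullet_irreducible T" "nonempty_diagram T" "nonempty_diagram (bullet_list (T' # Ts))"
proof -
  have irr: "\<forall>S\<in>set (T # T' # Ts). bullet_irreducible S"
    using assms unfolding bullet_decomposition_def by blast
  then have "\<forall>S\<in>set (T # T' # Ts). nonempty_diagram S"
    unfolding bullet_irreducible_def by blast
  then show "nonempty_diagram T" "nonempty_diagram (bullet_list (T' # Ts))"
    using nonempty_bullet_list[of "T' # Ts"] by simp_all
  show "P = T \<bullet>\<^sub>D bullet_list (T' # Ts)"
    using assms unfolding bullet_decomposition_def by simp
  show "bullet_decomposition (bullet_list (T' # Ts)) (T' # Ts)" "bullet_irreducible T"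
    using irr unfolding bullet_decomposition_def by simp_all
qed

text \<open>Two or more factors would exhibit \<open>P\<close> as the product of the first factor
  and the rest. This settles uniqueness whenever one of the lists is a singleton.\<close>

lemma bullet_decomposition_irreducible:
  assumes "bullet_decomposition P Ts" "bullet_irreducible P"
  shows "Ts = [P]"
proof (cases Ts rule: bullet_list.cases)
  case (3 T T' Ts')
  note d = bullet_decomposition_Cons_Cons[OF assms(1)[unfolded 3]]
  then show ?thesis
    using assms(2) d(4,5) unfolding bullet_irreducible_def by blast
qed (use assms in \<open>simp_all add: bullet_decomposition_def\<close>)

lemma bullet_decomposition_unique:
  "bullet_decomposition P Ts \<Longrightarrow> bullet_decomposition P Ss \<Longrightarrow> Ts = Ss"
proof (induction Ts arbitrary: P Ss rule: bullet_list.induct)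
  case 1
  then show ?case by (simp add: bullet_decomposition_def)
next
  case (2 T)
  then have "bullet_irreducible P" "T = P" by (simp_all add: bullet_decomposition_def)
  then show ?case using bullet_decomposition_irreducible[OF 2(2)] by simp
next
  case (3 T T' Ts)
  note dT = bullet_decomposition_Cons_Cons[OF "3.prems"(1)]
  show ?case
  proof (cases Ss rule: bullet_list.cases)
    case 1
    then show ?thesis using "3.prems"(2) by (simp add: bullet_decomposition_def)
  next
    case (2 S)
    then have "bullet_irreducible P" using "3.prems"(2) by (simp add: bullet_decomposition_def)
    then show ?thesis using bullet_decomposition_irreducible[OF "3.prems"(1)] by simp
  next
    case (3 S S' Ss')
    note dS = bullet_decomposition_Cons_Cons[OF \<open>bullet_decomposition P Ss\<close>[unfolded 3]]
    let ?Q = "bullet_list (T' # Ts)" and ?R = "bullet_list (S' # Ss')"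
    have eq: "T \<bullet>\<^sub>D ?Q = S \<bullet>\<^sub>D ?R" using dT(1) dS(1) by simp
    \<comment> \<open>Both first factors are irreducible, so the inequality holds in either
      direction. Equal orders are what cancellation needs.\<close>
    have "diagram_order T = diagram_order S"
      using irreducible_factor_le[OF dT(4) dS(3) dT(5) dS(5) eq]
        irreducible_factor_le[OF dS(4) dT(3) dS(5) dT(5) eq[symmetric]] by simp
    then have "diagram_of_order (diagram_order T) S"
      using nonempty_diagram_order[OF dS(4)] by simp
    then have "T = S" and QR: "?Q = ?R"
      using bullet_cancel[OF _ _ _ _ _ _ _ eq] nonempty_diagram_order[OF dT(4)]
        nonempty_diagram_order[OF dT(5)] nonempty_diagram_order[OF dS(5)] by blast+
    have "bullet_decomposition ?Q (S' # Ss')"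
      using dS(2) by (simp only: QR)
    then have "T' # Ts = S' # Ss'" by (rule "3.IH"[OF dT(2)])
    then show ?thesis using \<open>T = S\<close> 3 by simp
  qed
qed

theorem theorem3p9:
  fixes P :: diagram
  assumes "nonempty_diagram P"
  shows "(\<exists>!Ts. bullet_decomposition P Ts) \<and>
         (\<exists>!m. \<exists>Ts. bullet_decomposition P Ts \<and> length Ts = m)"
proof -
  obtain Ts where Ts: "bullet_decomposition P Ts"
    using bullet_decomposition_exists[OF assms] ..
  \<comment> \<open>This gives both claims: the only possible value of \<open>m\<close> is the
    length of \<open>Ts\<close>.\<close>
  then have "Ss = Ts" if "bullet_decomposition P Ss" for Ss
    using that bullet_decomposition_unique by blast
  with Ts show ?thesis by blast
qed

end
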